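(* Let $P$ be a Noetherian poset. Then the Scott space $\Sigma P$ is strongly well-filtered.
   Context: A poset $P$ is Noetherian if it satisfies the ascending chain condition: every ascending chain has a greatest member (equivalently, every directed subset has a largest element). A subset $U$ of a poset $P$ is Scott open if it is an upper set and, for every directed $D\subseteq P$ whose supremum exists, $\bigvee D\in U$ implies $D\cap U\neq\emptyset$; $\Sigma P$ is $P$ with the topology of Scott open sets. For a $T_0$-space $X$, a subset is saturated if it equals the intersection of all open sets containing it, and $Q(X)$ is the set of all nonempty compact saturated subsets of $X$ (compactness is the open-cover property). A family $\mathcal K\subseteq Q(X)$ is filtered if it is nonempty and any two members contain a common member of $\mathcal K$. A $T_0$-space $X$ is strongly well-filtered if for every filtered family $\{K_d: d\in D\}\subseteq Q(X)$, every $K\in Q(X)$ and every open $U$, $\bigcap_{d\in D}K_d\cap K\subseteq U$ implies $K_d\cap K\subseteq U$ for some $d\in D$. *)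

theory Defs
  imports "HOL-Analysis.Analysis"
begin

text \<open>
  A poset is a carrier \<open>P\<close> with a relation \<open>r\<close> such that \<^term>\<open>partial_order_on P r\<close>;
  \<^term>\<open>(x, y) \<in> r\<close> reads \<open>x \<le> y\<close>.
\<close>

text \<open>Ascending chains are sequences \<open>x\<^sub>0 \<le> x\<^sub>1 \<le> \<dots>\<close>, repetitions allowed.\<close>

definition noetherian :: "'a set \<Rightarrow> 'a rel \<Rightarrow> bool" where
  "noetherian P r \<longleftrightarrow>
     (\<forall>f :: nat \<Rightarrow> 'a. (\<forall>n. f n \<in> P) \<and> (\<forall>n. (f n, f (Suc n)) \<in> r)
        \<longrightarrow> (\<exists>m. \<forall>n. (f n, f m) \<in> r))"

definition directed_in :: "'a set \<Rightarrow> 'a rel \<Rightarrow> 'a set \<Rightarrow> bool" where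
  "directed_in P r D \<longleftrightarrow>
     D \<subseteq> P \<and> D \<noteq> {} \<and> (\<forall>x\<in>D. \<forall>y\<in>D. \<exists>z\<in>D. (x, z) \<in> r \<and> (y, z) \<in> r)"

definition is_supremum :: "'a set \<Rightarrow> 'a rel \<Rightarrow> 'a set \<Rightarrow> 'a \<Rightarrow> bool" where
  "is_supremum P r D s \<longleftrightarrow>
     s \<in> P \<and> (\<forall>x\<in>D. (x, s) \<in> r) \<and> (\<forall>u\<in>P. (\<forall>x\<in>D. (x, u) \<in> r) \<longrightarrow> (s, u) \<in> r)"

definition upper_set :: "'a set \<Rightarrow> 'a rel \<Rightarrow> 'a set \<Rightarrow> bool" where
  "upper_set P r U \<longleftrightarrow> U \<subseteq> P \<and> (\<forall>x\<in>U. \<forall>y\<in>P. (x, y) \<in> r \<longrightarrow> y \<in> U)"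

definition scott_open :: "'a set \<Rightarrow> 'a rel \<Rightarrow> 'a set \<Rightarrow> bool" where
  "scott_open P r U \<longleftrightarrow>
     upper_set P r U \<and>
     (\<forall>D s. directed_in P r D \<and> is_supremum P r D s \<and> s \<in> U \<longrightarrow> D \<inter> U \<noteq> {})"

text \<open>
  The following is meaningful whenever \<^const>\<open>scott_open\<close> satisfies \<^const>\<open>istopology\<close>,
  which is proved below for every \<open>r\<close>.
\<close>

definition scott_space :: "'a set \<Rightarrow> 'a rel \<Rightarrow> 'a topology" where
  "scott_space P r = topology (scott_open P r)"

definition saturated_in :: "'a topology \<Rightarrow> 'a set \<Rightarrow> bool" where
  "saturated_in X A \<longleftrightarrow> A \<subseteq> topspace X \<and> A = \<Inter>{U. openin X U \<and> A \<subseteq> U}"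

definition compact_saturated_sets :: "'a topology \<Rightarrow> 'a set set" where
  "compact_saturated_sets X = {K. K \<noteq> {} \<and> compactin X K \<and> saturated_in X K}"

text \<open>The index set of a filtered family plays no role, so families are sets of sets.\<close>

definition filtered_family :: "'a set set \<Rightarrow> bool" where
  "filtered_family \<K> \<longleftrightarrow> \<K> \<noteq> {} \<and> (\<forall>A\<in>\<K>. \<forall>B\<in>\<K>. \<exists>C\<in>\<K>. C \<subseteq> A \<inter> B)"

definition strongly_well_filtered :: "'a topology \<Rightarrow> bool" where
  "strongly_well_filtered X \<longleftrightarrow>
     t0_space X \<and>
     (\<forall>\<K> K U. \<K> \<subseteq> compact_saturated_sets X \<and> filtered_family \<K> \<and>
        K \<in> compact_saturated_sets X \<and> openin X U \<and> \<Inter>\<K> \<inter> K \<subseteq> U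
        \<longrightarrow> (\<exists>A\<in>\<K>. A \<inter> K \<subseteq> U))"

lemma istopology_scott_open: "istopology (scott_open P r)"
  unfolding istopology_def
proof (intro conjI allI impI)
  fix U V assume U: "scott_open P r U" and V: "scott_open P r V"
  show "scott_open P r (U \<inter> V)"
    unfolding scott_open_def
  proof (intro conjI allI impI)
    show "upper_set P r (U \<inter> V)"
      using U V unfolding scott_open_def upper_set_def by blast
  next
    fix D s assume D: "directed_in P r D \<and> is_supremum P r D s \<and> s \<in> U \<inter> V"
    obtain x where x: "x \<in> D" "x \<in> U" using U D unfolding scott_open_def by blast
    obtain y where y: "y \<in> D" "y \<in> V" using V D unfolding scott_open_def by blast
    obtain z where z: "z \<in> D" "z \<in> P" "(x, z) \<in> r" "(y, z) \<in> r"
      using D x(1) y(1) unfolding directed_in_def by blast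
    have "z \<in> U" "z \<in> V"
      using U V x y z unfolding scott_open_def upper_set_def by blast+
    then show "D \<inter> (U \<inter> V) \<noteq> {}" using z by blast
  qed
next
  fix \<U> assume *: "\<forall>U\<in>\<U>. scott_open P r U"
  show "scott_open P r (\<Union>\<U>)"
    unfolding scott_open_def
  proof (intro conjI allI impI)
    show "upper_set P r (\<Union>\<U>)"
      using * unfolding scott_open_def upper_set_def by blast
  next
    fix D s assume D: "directed_in P r D \<and> is_supremum P r D s \<and> s \<in> \<Union>\<U>"
    then obtain U where "U \<in> \<U>" "s \<in> U" by blast
    then have "D \<inter> U \<noteq> {}" using * D unfolding scott_open_def by blast
    then show "D \<inter> \<Union>\<U> \<noteq> {}" using \<open>U \<in> \<U>\<close> by blast
  qed
qed

lemma openin_scott_space: "openin (scott_space P r) U \<longleftrightarrow> scott_open P r U"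
  unfolding scott_space_def by (simp add: istopology_scott_open topology_inverse')

lemma topspace_scott_space: "topspace (scott_space P r) = P"
proof -
  have "scott_open P r P"
    unfolding scott_open_def upper_set_def directed_in_def by blast
  moreover have "U \<subseteq> P" if "scott_open P r U" for U
    using that unfolding scott_open_def upper_set_def by blast
  ultimately show ?thesis
    unfolding topspace_def openin_scott_space by blast
qed

lemma noetherian_iff_directed:
  assumes "partial_order_on P r"
  shows "noetherian P r \<longleftrightarrow>
    (\<forall>D. directed_in P r D \<longrightarrow> (\<exists>m\<in>D. \<forall>x\<in>D. (x, m) \<in> r))"
proof
  assume N: "noetherian P r"
  show "\<forall>D. directed_in P r D \<longrightarrow> (\<exists>m\<in>D. \<forall>x\<in>D. (x, m) \<in> r)"
  proof (intro allI impI, rule ccontr)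
    fix D assume D: "directed_in P r D" and no: "\<not> (\<exists>m\<in>D. \<forall>x\<in>D. (x, m) \<in> r)"
    have step: "\<exists>z\<in>D. (m, z) \<in> r \<and> (z, m) \<notin> r" if m: "m \<in> D" for m
    proof -
      obtain x where x: "x \<in> D" "(x, m) \<notin> r" using no m by blast
      obtain z where "z \<in> D" "(m, z) \<in> r" "(x, z) \<in> r"
        using D m x(1) unfolding directed_in_def by blast
      moreover have "(z, m) \<notin> r"
      proof
        assume "(z, m) \<in> r"
        with \<open>(x, z) \<in> r\<close> have "(x, m) \<in> r"
          by (rule transD[OF partial_order_onD(2)[OF assms]])
        with x(2) show False by simp
      qed
      ultimately show ?thesis by blast
    qed
    obtain d where "d \<in> D" using D unfolding directed_in_def by blast
    obtain g where g: "\<And>m. m \<in> D \<Longrightarrow> g m \<in> D \<and> (m, g m) \<in> r \<and> (g m, m) \<notin> r"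
      using step by metis
    define f where "f = (\<lambda>n. (g ^^ n) d)"
    have fD: "f n \<in> D" for n
      by (induction n) (simp_all add: f_def \<open>d \<in> D\<close> g)
    have fS: "(f n, f (Suc n)) \<in> r" "(f (Suc n), f n) \<notin> r" for n
      using g[OF fD[of n]] by (simp_all add: f_def)
    have "f n \<in> P" for n
      using fD[of n] D unfolding directed_in_def by (simp add: subset_iff)
    then obtain m where "\<forall>n. (f n, f m) \<in> r"
      using N[unfolded noetherian_def, THEN spec, of f] fS(1) by auto
    then have "(f (Suc m), f m) \<in> r" ..
    then show False using fS(2)[of m] by simp
  qed
next
  assume H: "\<forall>D. directed_in P r D \<longrightarrow> (\<exists>m\<in>D. \<forall>x\<in>D. (x, m) \<in> r)"
  show "noetherian P r"
    unfolding noetherian_def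
  proof (intro allI impI)
    fix f :: "nat \<Rightarrow> 'a"
    assume f: "(\<forall>n. f n \<in> P) \<and> (\<forall>n. (f n, f (Suc n)) \<in> r)"
    have mono: "(f i, f j) \<in> r" if "i \<le> j" for i j
      using that
    proof (induction rule: dec_induct)
      case base
      have "f i \<in> P" using f by simp
      then show ?case using refl_onD[OF partial_order_onD(1)[OF assms]] by simp
    next
      case (step n)
      have "(f n, f (Suc n)) \<in> r" using f by simp
      with step.IH show ?case
        by (rule transD[OF partial_order_onD(2)[OF assms]])
    qed
    have "directed_in P r (range f)"
      unfolding directed_in_def
    proof (intro conjI ballI)
      fix x y assume "x \<in> range f" "y \<in> range f"
      then obtain i j where "x = f i" "y = f j" by blast
      then show "\<exists>z\<in>range f. (x, z) \<in> r \<and> (y, z) \<in> r"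
        using mono[of i "max i j"] mono[of j "max i j"] by auto
    qed (simp_all add: f image_subset_iff)
    with H[THEN spec, of "range f"] have "\<exists>m\<in>range f. \<forall>x\<in>range f. (x, m) \<in> r"
      by (rule mp)
    then show "\<exists>m. \<forall>n. (f n, f m) \<in> r" by simp
  qed
qed

end

theory Submission
  imports Defs
begin

text \<open>
  In a Noetherian poset a directed set has a greatest element, so the Scott open sets are exactly
  the upper sets. For a fixed \<open>K\<close> and \<open>U\<close>, the elements \<open>x\<close> with \<open>\<up>x \<inter> K \<subseteq> U\<close> therefore form an
  open set \<open>V\<close>, and an upper set \<open>A\<close> satisfies \<open>A \<inter> K \<subseteq> U\<close> iff \<open>A \<subseteq> V\<close>. This reduces strong
  well-filteredness to well-filteredness. For the latter, if no member of the family lies in \<open>V\<close>,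
  take by Zorn an open \<open>W \<supseteq> V\<close> maximal with this property. Maximality makes the complement of \<open>W\<close>
  directed, and its greatest element lies in every member of the family but not in \<open>V\<close>.
\<close>

text \<open>The greatest element \<open>m\<close> of a directed set is an upper bound, so it lies
  above the supremum \<open>s\<close>; an upper set containing \<open>s\<close> then contains
  \<open>m\<close>, a member of the directed set.\<close>

lemma scott_open_iff_upper_set:
  assumes "partial_order_on P r" and "noetherian P r"
  shows "scott_open P r U \<longleftrightarrow> upper_set P r U"
proof
  assume U: "upper_set P r U"
  show "scott_open P r U"
    unfolding scott_open_def
  proof (intro conjI allI impI U)
    fix D s assume H: "directed_in P r D \<and> is_supremum P r D s \<and> s \<in> U"
    then obtain m where m: "m \<in> D" "\<forall>x\<in>D. (x, m) \<in> r"
      using assms noetherian_iff_directed by blast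
    have "m \<in> P" using H m(1) unfolding directed_in_def by blast
    moreover from this have "(s, m) \<in> r" using H m(2) unfolding is_supremum_def by blast
    ultimately have "m \<in> U" using H U unfolding upper_set_def by blast
    then show "D \<inter> U \<noteq> {}" using m(1) by blast
  qed
qed (simp add: scott_open_def)

lemma upper_set_principal:
  assumes "trans r"
  shows "upper_set P r {y \<in> P. (x, y) \<in> r}"
  using assms unfolding upper_set_def by (blast dest: transD)

text \<open>Every Scott open set is an upper set, and this property survives intersections.\<close>

lemma upper_set_saturated_scott:
  assumes "saturated_in (scott_space P r) A"
  shows "upper_set P r A"
  unfolding upper_set_def
proof (intro conjI ballI impI)
  show "A \<subseteq> P"
    using assms unfolding saturated_in_def topspace_scott_space by blast
next
  fix x y assume xy: "x \<in> A" "y \<in> P" "(x, y) \<in> r"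
  have "y \<in> U" if "scott_open P r U" "A \<subseteq> U" for U
    using that xy unfolding scott_open_def upper_set_def by blast
  then have "y \<in> \<Inter>{U. openin (scott_space P r) U \<and> A \<subseteq> U}"
    by (simp add: openin_scott_space)
  with assms show "y \<in> A" unfolding saturated_in_def by blast
qed

text \<open>A finite nonempty subfamily of a chain contains its own union, so a finite subcover
  collapses to one set. This supplies upper bounds for Zorn's lemma.\<close>

lemma compactin_subset_chain:
  assumes "compactin X K" and "K \<subseteq> \<Union>\<C>" and "\<C> \<noteq> {}"
    and "\<And>U. U \<in> \<C> \<Longrightarrow> openin X U" and chain: "subset.chain UNIV \<C>"
  obtains U where "U \<in> \<C>" "K \<subseteq> U"
proof -
  obtain \<F> where F: "finite \<F>" "\<F> \<subseteq> \<C>" "K \<subseteq> \<Union>\<F>"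
    using assms(1,2,4) unfolding compactin_def by meson
  show thesis
  proof (cases "\<F> = {}")
    \<comment> \<open>Here \<open>K\<close> is empty, and any member of the nonempty chain will
      do.\<close>
    case True
    with F assms(3) that show ?thesis by blast
  next
    case False
    have "subset.chain \<C> \<F>"
      using chain F(2) unfolding subset_chain_def by blast
    then have "\<Union>\<F> \<in> \<F>" using F(1) False by (metis Union_in_chain)
    with F that show ?thesis by blast
  qed
qed

text \<open>Principal upper sets are open, and by antisymmetry one of the two generated by distinct
  points omits the other point.\<close>

lemma t0_scott_space_noetherian:
  assumes "partial_order_on P r" and "noetherian P r"
  shows "t0_space (scott_space P r)"
  unfolding t0_space_def topspace_scott_space openin_scott_space
proof (intro ballI impI)
  fix x y assume xy: "x \<in> P" "y \<in> P" "x \<noteq> y"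
  have open_up: "scott_open P r {z \<in> P. (w, z) \<in> r}" for w
    using upper_set_principal[OF partial_order_onD(2)[OF assms(1)]]
      scott_open_iff_upper_set[OF assms] by blast
  have refl: "(x, x) \<in> r" "(y, y) \<in> r"
    using refl_onD[OF partial_order_onD(1)[OF assms(1)]] xy by blast+
  have "(x, y) \<notin> r \<or> (y, x) \<notin> r"
    using antisymD[OF partial_order_onD(3)[OF assms(1)]] xy(3) by blast
  then show "\<exists>U. scott_open P r U \<and> (x \<notin> U) = (y \<in> U)"
  proof
    assume "(x, y) \<notin> r"
    then show ?thesis using open_up[of x] refl xy by (intro exI[of _ "{z \<in> P. (x, z) \<in> r}"]) simp
  next
    assume "(y, x) \<notin> r"
    then show ?thesis using open_up[of y] refl xy by (intro exI[of _ "{z \<in> P. (y, z) \<in> r}"]) simp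
  qed
qed

lemma well_filtered_scott_space_noetherian:
  assumes po: "partial_order_on P r" and N: "noetherian P r"
    and Q: "\<K> \<subseteq> compact_saturated_sets (scott_space P r)" and filt: "filtered_family \<K>"
    and V: "upper_set P r V" and sub: "\<Inter>\<K> \<subseteq> V"
  shows "\<exists>A\<in>\<K>. A \<subseteq> V"
proof (rule ccontr)
  assume no: "\<not> (\<exists>A\<in>\<K>. A \<subseteq> V)"
  have upK: "upper_set P r A" if "A \<in> \<K>" for A
    using that Q upper_set_saturated_scott unfolding compact_saturated_sets_def by blast
  have refl: "(x, x) \<in> r" if "x \<in> P" for x
    using refl_onD[OF partial_order_onD(1)[OF po]] that by blast
  define S where "S = {W. upper_set P r W \<and> V \<subseteq> W \<and> (\<forall>A\<in>\<K>. \<not> A \<subseteq> W)}"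
  have "\<exists>W\<in>S. \<forall>X\<in>S. W \<subseteq> X \<longrightarrow> X = W"
  proof (rule subset_Zorn_nonempty)
    show "S \<noteq> {}" using V no unfolding S_def by blast
  next
    fix \<C> assume ne: "\<C> \<noteq> {}" and chain: "subset.chain S \<C>"
    have CS: "\<C> \<subseteq> S" using chain unfolding subset_chain_def by blast
    have "upper_set P r (\<Union>\<C>)"
      using CS unfolding S_def upper_set_def by blast
    moreover have "V \<subseteq> \<Union>\<C>" using CS ne unfolding S_def by blast
    moreover have "\<not> A \<subseteq> \<Union>\<C>" if A: "A \<in> \<K>" for A
    proof
      assume "A \<subseteq> \<Union>\<C>"
      moreover have "compactin (scott_space P r) A"
        using A Q unfolding compact_saturated_sets_def by blast
      moreover have "openin (scott_space P r) U" if "U \<in> \<C>" for U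
        using that CS unfolding openin_scott_space scott_open_iff_upper_set[OF po N] S_def
        by blast
      moreover have "subset.chain UNIV \<C>"
        using chain unfolding subset_chain_def by blast
      ultimately obtain U where "U \<in> \<C>" "A \<subseteq> U"
        using ne compactin_subset_chain by metis
      with A CS show False unfolding S_def by blast
    qed
    ultimately show "\<Union>\<C> \<in> S" unfolding S_def by blast
  qed
  then obtain W where W: "W \<in> S" and max: "\<And>X. X \<in> S \<Longrightarrow> W \<subseteq> X \<Longrightarrow> X = W" by blast
  have upW: "upper_set P r W" and VW: "V \<subseteq> W" and notW: "\<And>A. A \<in> \<K> \<Longrightarrow> \<not> A \<subseteq> W"
    using W unfolding S_def by blast+
  have meets: "\<exists>z \<in> A. z \<in> P - W" if "A \<in> \<K>" for A
    using notW[OF that] upK[OF that] unfolding upper_set_def by blast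
  \<comment> \<open>Adjoining the principal upper set of \<open>x\<close> to \<open>W\<close> gives
    a strictly larger upper set, which by maximality must leave \<open>S\<close>; the only way is to
    contain a member of the family.\<close>
  have extend: "\<exists>A\<in>\<K>. A \<subseteq> W \<union> {z \<in> P. (x, z) \<in> r}" if x: "x \<in> P - W" for x
  proof (rule ccontr)
    assume "\<not> ?thesis"
    moreover have "upper_set P r (W \<union> {z \<in> P. (x, z) \<in> r})"
      using upW upper_set_principal[OF partial_order_onD(2)[OF po], of P x]
      unfolding upper_set_def by blast
    ultimately have "W \<union> {z \<in> P. (x, z) \<in> r} \<in> S" using VW unfolding S_def by blast
    then show False using max[of "W \<union> {z \<in> P. (x, z) \<in> r}"] x refl by blast
  qed
  have "directed_in P r (P - W)"
    unfolding directed_in_def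
  proof (intro conjI ballI)
    show "P - W \<noteq> {}" using filt meets unfolding filtered_family_def by blast
  next
    fix x y assume "x \<in> P - W" "y \<in> P - W"
    then obtain A B where "A \<in> \<K>" "A \<subseteq> W \<union> {z \<in> P. (x, z) \<in> r}"
      and "B \<in> \<K>" "B \<subseteq> W \<union> {z \<in> P. (y, z) \<in> r}"
      using extend by meson
    \<comment> \<open>A point of \<open>C\<close> outside \<open>W\<close> lies in both
      \<open>A\<close> and \<open>B\<close>, hence above both \<open>x\<close> and
      \<open>y\<close>.\<close>
    moreover obtain C where "C \<in> \<K>" "C \<subseteq> A \<inter> B"
      using filt \<open>A \<in> \<K>\<close> \<open>B \<in> \<K>\<close> unfolding filtered_family_def by meson
    moreover obtain z where "z \<in> C" "z \<in> P - W" using meets \<open>C \<in> \<K>\<close> by blast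
    ultimately show "\<exists>z\<in>P - W. (x, z) \<in> r \<and> (y, z) \<in> r" by blast
  qed blast
  then obtain m where m: "m \<in> P - W" "\<And>x. x \<in> P - W \<Longrightarrow> (x, m) \<in> r"
    using N noetherian_iff_directed[OF po] by meson
  \<comment> \<open>Each member has a point outside \<open>W\<close>; this point is below
    \<open>m\<close>, and members are upper sets.\<close>
  have "m \<in> A" if A: "A \<in> \<K>" for A
  proof -
    obtain z where "z \<in> A" "z \<in> P - W" using meets[OF A] by blast
    then show ?thesis using upK[OF A] m unfolding upper_set_def by blast
  qed
  then show False using sub VW m(1) by blast
qed

theorem proposition3p17:
  fixes P :: "'a set" and r :: "'a rel"
  assumes "partial_order_on P r"
    and "noetherian P r"
  shows "strongly_well_filtered (scott_space P r)"
  unfolding strongly_well_filtered_def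
proof (intro conjI allI impI t0_scott_space_noetherian[OF assms], elim conjE)
  fix \<K> K U
  assume Q: "\<K> \<subseteq> compact_saturated_sets (scott_space P r)" and filt: "filtered_family \<K>"
    and sub: "\<Inter>\<K> \<inter> K \<subseteq> U"
  define V where "V = {x \<in> P. \<forall>y\<in>K. (x, y) \<in> r \<longrightarrow> y \<in> U}"
  assume "K \<in> compact_saturated_sets (scott_space P r)"
  then have KP: "K \<subseteq> P"
    unfolding compact_saturated_sets_def saturated_in_def topspace_scott_space by blast
  have upK: "upper_set P r A" if "A \<in> \<K>" for A
    using that Q upper_set_saturated_scott unfolding compact_saturated_sets_def by blast
  have "upper_set P r V"
    \<comment> \<open>Moving \<open>x\<close> upwards only shrinks the set of points of
      \<open>K\<close> above it.\<close>
    unfolding upper_set_def V_def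
    using transD[OF partial_order_onD(2)[OF assms(1)]] by blast
  moreover have "\<Inter>\<K> \<subseteq> V"
  proof
    fix x assume x: "x \<in> \<Inter>\<K>"
    have "x \<in> P" using x filt upK unfolding filtered_family_def upper_set_def by blast
    moreover have "y \<in> U" if y: "y \<in> K" "(x, y) \<in> r" for y
    proof -
      have "y \<in> \<Inter>\<K>" using x y KP upK unfolding upper_set_def by blast
      with y sub show ?thesis by blast
    qed
    ultimately show "x \<in> V" unfolding V_def by blast
  qed
  ultimately obtain A where "A \<in> \<K>" "A \<subseteq> V"
    using well_filtered_scott_space_noetherian[OF assms Q filt] by blast
  \<comment> \<open>Taking \<open>x = y\<close> in the definition of \<open>V\<close> turns
    \<open>A \<subseteq> V\<close> back into \<open>A \<inter> K \<subseteq> U\<close>.\<close>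
  moreover have "(y, y) \<in> r" if "y \<in> K" for y
    using refl_onD[OF partial_order_onD(1)[OF assms(1)]] that KP by blast
  ultimately show "\<exists>A\<in>\<K>. A \<inter> K \<subseteq> U" unfolding V_def by blast
qed

end
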